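(* Let $A$ be an $n\times n$ M-matrix. Let $S_1,\dots,S_m$ be the singular classes of $A$, and let $\mu_i=\max(S_i)$. Set $$\chi=\{(j,\mu_i) : i\in\{1,\dots,m\},\ j>\mu_i \text{ and } j \text{ has access to } \mu_i \text{ in } \mathcal{G}(A)\}.$$ Then $A$ admits a factorization $A=LU$, where $L$ is a nonsingular lower triangular M-matrix, and $U=[u_{jk}]$ is an M-matrix such that for all $j>k$, $u_{jk}=0$ whenever $(j,k)\notin\chi$, and such that $u_{jj}=0$ if and only if $j=\mu_i$ for some $i\in\{1,\dots,m\}$.
   Context: All matrices are real $n\times n$, and $\langle n\rangle=\{1,\dots,n\}$. An M-matrix is a matrix of the form $\alpha I-P$ with $P$ entrywise nonnegative and $\alpha\in\mathbb{R}$ at least the spectral radius of $P$ (so M-matrices may be singular). The directed graph $\mathcal{G}(X)$ of $X=[x_{ij}]$ has vertex set $\langle n\rangle$ and edges $\{(i,j): x_{ij}\neq 0\}$. A vertex $j$ has access to $k$ if there is a directed path from $j$ to $k$; the empty path is allowed, so every vertex has access to itself. The classes of $X$ are the equivalence classes of the relation "$j$ has access to $k$ and $k$ has access to $j$" in $\mathcal{G}(X)$. A class $J$ of $X$ is a singular class of $X$ if the principal submatrix $X_{JJ}$ (rows and columns indexed by $J$) is singular. *)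

theory Defs
  imports "Jordan_Normal_Form.Spectral_Radius" "Jordan_Normal_Form.DL_Submatrix"
    "Graph_Theory.Digraph"
begin

text \<open>As everywhere in \<open>Jordan_Normal_Form\<close>, rows and columns are numbered from \<open>0\<close>, so the
  index set \<open>{1, \<dots>, n}\<close> of the mathematical text is \<open>{0..<n}\<close> here; the shift preserves the order.\<close>

text \<open>The library's spectral radius is that of a complex matrix, so a real matrix is embedded first.\<close>

definition M_matrix :: "real mat \<Rightarrow> bool" where
  "M_matrix A \<longleftrightarrow> (\<exists>n \<alpha> P. P \<in> carrier_mat n n \<and> (\<forall>i<n. \<forall>j<n. 0 \<le> P $$ (i, j))
     \<and> spectral_radius (map_mat complex_of_real P) \<le> \<alpha>
     \<and> A = \<alpha> \<cdot>\<^sub>m 1\<^sub>m n - P)"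

definition mat_graph :: "real mat \<Rightarrow> (nat, nat \<times> nat) pre_digraph" where
  "mat_graph X = \<lparr>verts = {0..<dim_row X},
     arcs = {(i, j). i < dim_row X \<and> j < dim_row X \<and> X $$ (i, j) \<noteq> 0}, tail = fst, head = snd\<rparr>"

text \<open>\<open>reachable\<close> admits the empty path, but only at vertices of the graph.\<close>

definition has_access :: "real mat \<Rightarrow> nat \<Rightarrow> nat \<Rightarrow> bool" where
  "has_access X j k \<longleftrightarrow> reachable (mat_graph X) j k"

definition mat_classes :: "real mat \<Rightarrow> nat set set" where
  "mat_classes X = quotient {0..<dim_row X} {(j, k). has_access X j k \<and> has_access X k j}"

definition singular_classes :: "real mat \<Rightarrow> nat set set" where
  "singular_classes X = {J \<in> mat_classes X. \<not> invertible_mat (submatrix X J J)}"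

definition chi :: "real mat \<Rightarrow> (nat \<times> nat) set" where
  "chi A = {(j, Max S) | j S. S \<in> singular_classes A \<and> j > Max S \<and> has_access A j (Max S)}"

definition lower_triangular :: "real mat \<Rightarrow> bool" where
  "lower_triangular L \<longleftrightarrow> (\<forall>i<dim_row L. \<forall>j<dim_col L. i < j \<longrightarrow> L $$ (i, j) = 0)"

end

theory Submission
  imports Defs
begin

text \<open>
  The factorization is produced by Gaussian elimination without row exchanges, column by column,
  where a column whose pivot vanishes is left as it is. Since off-diagonal entries are nonpositive,
  elimination with positive pivots only adds nonnegative multiples of earlier rows to later ones.
  It therefore keeps the off-diagonal entries of \<open>U\<close> nonpositive, the accumulated row operations
  \<open>W\<close> (with \<open>U = W A\<close>) are nonnegative, and \<open>L\<close> (with \<open>A = L U\<close>) is unit lower triangular with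
  nonpositive off-diagonal entries. Every entry of \<open>U\<close> that fills in joins two vertices connected
  by a path of \<open>A\<close>.

  The crux is the sign of the pivots: \<open>u\<^sub>k\<^sub>k \<ge> 0\<close>, with equality at most when
  \<open>k\<close> is the largest element of its class \<open>J\<close>. If \<open>A\<close> had a positive vector \<open>x\<close> with \<open>A x \<ge> 0\<close>,
  row \<open>k\<close> of \<open>W\<close>, restricted to \<open>J\<close>, would give \<open>u\<^sub>k\<^sub>k x\<^sub>k \<ge> \<Sum> (- u\<^sub>k\<^sub>j) x\<^sub>j \<ge> 0\<close>,
  the sum being over the \<open>j \<noteq> k\<close> in \<open>J\<close>. In general there are
  only positive \<open>x\<close> with \<open>A x \<ge> - \<epsilon> x\<close>, one for each \<open>\<epsilon> > 0\<close>
  (\<open>exists_positive_super_solution\<close>); but the ratios of the entries of \<open>x\<close> within a class are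
  bounded independently of \<open>\<epsilon>\<close> (\<open>super_solution_harnack\<close>), so that \<open>\<epsilon>\<close> can be sent to \<open>0\<close>
  (\<open>pivot_lower_bound\<close>). If \<open>k\<close> is not the largest element of \<open>J\<close>, the support of
  row \<open>k\<close> of \<open>W\<close> misses that element, hence some edge inside \<open>J\<close> leaves the support; it makes
  some \<open>u\<^sub>k\<^sub>j\<close> with \<open>j \<noteq> k\<close> negative, and the pivot positive (\<open>U_pivot\<close>).

  Consequently \<open>U\<close> is upper triangular within each class. So \<open>A\<^sub>J\<^sub>J\<close> is singular exactly
  when a pivot in \<open>J\<close> vanishes, and then the pivot is the one at \<open>max J\<close>; this locates the nonzero
  entries below the diagonal of \<open>U\<close>. Moreover the graph of \<open>U\<close> has no cycles besides loops, so
  the eigenvalues of \<open>\<alpha> I - U\<close> are among its diagonal entries, and \<open>U\<close> is an M-matrix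
  (\<open>M_matrix_if_wf\<close>). The last argument applies to \<open>L\<close> as well.
\<close>

section \<open>Super-solutions of an M-matrix\<close>

lemma mult_mat_vec_nth_sum:
  assumes "P \<in> carrier_mat n n" "v \<in> carrier_vec n" "i < n"
  shows "(P *\<^sub>v v) $ i = (\<Sum>j<n. P $$ (i, j) * v $ j)"
  using assms by (simp add: scalar_prod_def atLeast0LessThan)

lemma pow_mat_Suc_left:
  assumes Q: "Q \<in> carrier_mat n n"
  shows "Q ^\<^sub>m Suc k = Q * Q ^\<^sub>m k"
proof (induction k)
  case (Suc k)
  have "Q ^\<^sub>m Suc (Suc k) = (Q * Q ^\<^sub>m k) * Q" using Suc by simp
  also have "\<dots> = Q * (Q ^\<^sub>m k * Q)"
    using Q by (intro assoc_mult_mat[where ?n\<^sub>1 = n]) auto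
  finally show ?case by simp
qed (use Q in simp)

lemma eigenvalue_smult_cancel:
  fixes P :: "'a :: field mat"
  assumes P: "P \<in> carrier_mat n n" and c: "c \<noteq> 0" and ev: "eigenvalue (c \<cdot>\<^sub>m P) k"
  shows "eigenvalue P (k / c)"
proof -
  obtain v where v: "v \<in> carrier_vec n" "v \<noteq> 0\<^sub>v n" "(c \<cdot>\<^sub>m P) *\<^sub>v v = k \<cdot>\<^sub>v v"
    using ev P unfolding eigenvalue_def eigenvector_def by auto
  have "P *\<^sub>v v = (k / c) \<cdot>\<^sub>v v"
  proof (rule eq_vecI)
    fix i assume "i < dim_vec ((k / c) \<cdot>\<^sub>v v)"
    then have i: "i < n" using v by simp
    have "((c \<cdot>\<^sub>m P) *\<^sub>v v) $ i = (\<Sum>j<n. (c \<cdot>\<^sub>m P) $$ (i, j) * v $ j)"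
      by (rule mult_mat_vec_nth_sum) (use P v i in auto)
    also have "\<dots> = c * (P *\<^sub>v v) $ i"
      unfolding mult_mat_vec_nth_sum[OF P v(1) i] sum_distrib_left
      using P i by (intro sum.cong) auto
    finally have "c * (P *\<^sub>v v) $ i = k * v $ i" using v i by simp
    then show "(P *\<^sub>v v) $ i = ((k / c) \<cdot>\<^sub>v v) $ i"
      using v i c by (simp add: field_simps)
  qed (use P v in simp)
  then show ?thesis using v P unfolding eigenvalue_def eigenvector_def by auto
qed

text \<open>\<open>P / \<beta>\<close> has spectral radius less than \<open>1\<close>.\<close>
lemma bounded_powers_above_spectral_radius:
  assumes P: "P \<in> carrier_mat n n" and n: "n > 0"
    and sr: "spectral_radius (map_mat complex_of_real P) < \<beta>"
  shows "\<exists>c. \<forall>k. norm_bound (((1 / \<beta>) \<cdot>\<^sub>m P) ^\<^sub>m k) c"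
proof -
  let ?C = "map_mat complex_of_real"
  let ?Q = "(1 / \<beta>) \<cdot>\<^sub>m P"
  have CP: "?C P \<in> carrier_mat n n" and CQ: "?C ?Q \<in> carrier_mat n n" and Q: "?Q \<in> carrier_mat n n"
    using P by auto
  have "0 \<le> spectral_radius (?C P)"
    using spectral_radius_mem_max(1)[OF CP n] by auto
  then have b: "\<beta> > 0" using sr by simp
  obtain k where k: "eigenvalue (?C ?Q) k" and srQ: "spectral_radius (?C ?Q) = norm k"
    using spectral_radius_mem_max(1)[OF CQ n] unfolding spectrum_def by auto
  have "?C ?Q = complex_of_real (1 / \<beta>) \<cdot>\<^sub>m ?C P"
    by (rule eq_matI) (use P in auto)
  then have "eigenvalue (?C P) (k / complex_of_real (1 / \<beta>))"
    using eigenvalue_smult_cancel[OF CP, of "complex_of_real (1 / \<beta>)" k] k b by simp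
  then have "norm (k / complex_of_real (1 / \<beta>)) \<le> spectral_radius (?C P)"
    by (intro spectral_radius_mem_max(2)[OF CP n]) (auto simp: spectrum_def)
  then have "\<beta> * norm k \<le> spectral_radius (?C P)"
    using b by (simp add: norm_mult norm_divide field_simps)
  then have "\<beta> * norm k < \<beta> * 1" using sr by simp
  then have "norm k < 1" using b by (simp only: mult_less_cancel_left_pos)
  then obtain c where c: "\<And>j. norm_bound (?C ?Q ^\<^sub>m j) c"
    using spectral_radius_jnf_norm_bound_less_1_upper_triangular[OF CQ] srQ by auto
  have "norm_bound (?Q ^\<^sub>m j) c" for j
  proof (rule norm_boundI)
    fix p q assume "p < dim_row (?Q ^\<^sub>m j)" "q < dim_col (?Q ^\<^sub>m j)"
    then have pq: "p < n" "q < n" using pow_carrier_mat[OF Q, of j] by (metis carrier_matD)+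
    have "?C ?Q ^\<^sub>m j = ?C (?Q ^\<^sub>m j)"
      by (rule of_real_hom.mat_hom_pow[OF Q, symmetric])
    then have "norm (?C (?Q ^\<^sub>m j) $$ (p, q)) \<le> c"
      using c[of j] pq Q P unfolding norm_bound_def by (auto simp: pow_mat_dim)
    then show "norm ((?Q ^\<^sub>m j) $$ (p, q)) \<le> c"
      using pq Q P by (auto simp: pow_mat_dim)
  qed
  then show ?thesis by blast
qed

text \<open>A positive vector \<open>x\<close> with \<open>P x \<le> \<gamma> x\<close> is given by a partial sum of the Neumann series
  \<open>\<Sum>\<^sub>k (P / \<gamma>)\<^sup>k 1\<close>, where \<open>1\<close> is the all-ones vector. No convergence is needed: it is enough
  that \<open>(P / \<gamma>)\<^sup>N 1 \<le> 1\<close> for some \<open>N \<ge> 1\<close>.\<close>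
lemma exists_positive_super_solution:
  assumes P: "P \<in> carrier_mat n n" and nonneg: "\<And>i j. i < n \<Longrightarrow> j < n \<Longrightarrow> 0 \<le> P $$ (i, j)"
    and sr: "spectral_radius (map_mat complex_of_real P) < \<gamma>"
  shows "\<exists>x. (\<forall>i<n. 0 < x i) \<and> (\<forall>i<n. (\<Sum>j<n. P $$ (i, j) * x j) \<le> \<gamma> * x i)"
proof (cases "n = 0")
  case False
  then have n: "n > 0" by simp
  let ?C = "map_mat complex_of_real"
  have CP: "?C P \<in> carrier_mat n n" using P by auto
  have sr0: "0 \<le> spectral_radius (?C P)"
    using spectral_radius_mem_max(1)[OF CP n] by auto
  \<comment> \<open>The powers of \<open>P / \<beta>\<close> are bounded for some \<open>\<beta> < \<gamma>\<close>, hence those of \<open>P / \<gamma>\<close> tend to \<open>0\<close>.\<close>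
  define \<beta> where "\<beta> = (spectral_radius (?C P) + \<gamma>) / 2"
  have b: "spectral_radius (?C P) < \<beta>" "\<beta> < \<gamma>" "0 < \<beta>" "0 < \<gamma>"
    using sr sr0 unfolding \<beta>_def by auto
  define Q where "Q = (1 / \<beta>) \<cdot>\<^sub>m P"
  have Q: "Q \<in> carrier_mat n n" using P unfolding Q_def by simp
  obtain c where c: "\<And>k. norm_bound (Q ^\<^sub>m k) c"
    using bounded_powers_above_spectral_radius[OF P n b(1)] unfolding Q_def by blast
  \<comment> \<open>\<open>y k\<close> is \<open>Q\<^sup>k\<close> applied to the all-ones vector.\<close>
  define y where "y k i = (\<Sum>j<n. (Q ^\<^sub>m k) $$ (i, j))" for k i
  have y_bound: "y k i \<le> real n * c" if "i < n" for k i
  proof -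
    have "(Q ^\<^sub>m k) $$ (i, j) \<le> c" if "j < n" for j
    proof -
      have "norm ((Q ^\<^sub>m k) $$ (i, j)) \<le> c"
        using c[of k] that \<open>i < n\<close> carrier_matD[OF pow_carrier_mat[OF Q, of k]]
        unfolding norm_bound_def by metis
      then show ?thesis by simp
    qed
    then have "y k i \<le> (\<Sum>j<n. c)" unfolding y_def by (intro sum_mono) auto
    then show ?thesis by simp
  qed
  have y0: "y 0 i = 1" if "i < n" for i
  proof -
    have "y 0 i = (\<Sum>j<n. if i = j then 1 else 0)"
      unfolding y_def using that Q by (intro sum.cong) auto
    also have "\<dots> = 1" using that by simp
    finally show ?thesis .
  qed
  have y_Suc: "(\<Sum>l<n. P $$ (i, l) * y k l) = \<beta> * y (Suc k) i" if i: "i < n" for k i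
  proof -
    have Qk: "Q ^\<^sub>m k \<in> carrier_mat n n" using Q by simp
    have "Q ^\<^sub>m Suc k = Q * Q ^\<^sub>m k"
      by (rule pow_mat_Suc_left[OF Q])
    then have "y (Suc k) i = (\<Sum>j<n. \<Sum>l<n. Q $$ (i, l) * (Q ^\<^sub>m k) $$ (l, j))"
      unfolding y_def using i Q Qk
      by (intro sum.cong) (auto simp: scalar_prod_def atLeast0LessThan)
    also have "\<dots> = (\<Sum>l<n. \<Sum>j<n. Q $$ (i, l) * (Q ^\<^sub>m k) $$ (l, j))" by (rule sum.swap)
    also have "\<dots> = (\<Sum>l<n. P $$ (i, l) * y k l) / \<beta>"
      unfolding y_def sum_divide_distrib using i P b
      by (intro sum.cong) (auto simp: Q_def sum_distrib_left sum_divide_distrib)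
    finally show ?thesis using b by simp
  qed
  have y_nonneg: "0 \<le> y k i" if "i < n" for k i
    using that
  proof (induction k arbitrary: i)
    case 0
    then show ?case by (simp add: y0)
  next
    case (Suc k)
    have "0 \<le> \<beta> * y (Suc k) i"
      unfolding y_Suc[OF Suc.prems, symmetric] using Suc nonneg by (intro sum_nonneg) auto
    then show ?case using b by (simp add: zero_le_mult_iff)
  qed
  define r where "r = \<beta> / \<gamma>"
  have r: "0 < r" "r < 1" "\<gamma> * r = \<beta>" unfolding r_def using b by auto
  have "(\<lambda>N. r ^ N * (real n * c)) \<longlonglongrightarrow> 0 * (real n * c)"
    using r by (intro tendsto_mult LIMSEQ_power_zero tendsto_const) auto
  then have "\<forall>\<^sub>F N in sequentially. r ^ N * (real n * c) < 1"
    by (intro order_tendstoD(2)[where y = 0]) auto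
  then obtain N where N: "r ^ N * (real n * c) < 1" "N \<ge> 1"
    using eventually_happens[OF eventually_conj[OF _ eventually_ge_at_top[of 1]]] by force
  define x where "x i = (\<Sum>k<N. r ^ k * y k i)" for i
  have "0 < x i" if "i < n" for i
  proof -
    have "r ^ 0 * y 0 i \<le> x i"
      unfolding x_def using N r y_nonneg[OF that] by (intro member_le_sum) auto
    then show ?thesis using y0[OF that] by simp
  qed
  moreover have "(\<Sum>j<n. P $$ (i, j) * x j) \<le> \<gamma> * x i" if i: "i < n" for i
  proof -
    have "(\<Sum>j<n. P $$ (i, j) * x j) = (\<Sum>k<N. \<Sum>j<n. r ^ k * (P $$ (i, j) * y k j))"
      unfolding x_def sum_distrib_left by (subst sum.swap) (simp add: mult.left_commute)
    also have "\<dots> = (\<Sum>k<N. r ^ k * (\<beta> * y (Suc k) i))"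
      by (simp add: sum_distrib_left[symmetric] y_Suc[OF i])
    also have "\<dots> = \<gamma> * (\<Sum>k<N. r ^ Suc k * y (Suc k) i)"
      unfolding sum_distrib_left using r(3)[symmetric] by (simp add: ac_simps)
    \<comment> \<open>The shifted sum is \<open>x i\<close> without its first term and with one more term at the end.\<close>
    also have "(\<Sum>k<N. r ^ Suc k * y (Suc k) i) = x i - y 0 i + r ^ N * y N i"
      unfolding x_def sum.lessThan_Suc_shift[symmetric, of "\<lambda>k. r ^ k * y k i"]
      using sum.lessThan_Suc_shift[of "\<lambda>k. r ^ k * y k i" N] by simp
    also have "\<gamma> * (x i - y 0 i + r ^ N * y N i) \<le> \<gamma> * x i"
    proof -
      have "r ^ N * y N i \<le> r ^ N * (real n * c)" using y_bound[OF i] r by simp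
      then show ?thesis using N y0[OF i] b by (intro mult_left_mono) auto
    qed
    finally show ?thesis .
  qed
  ultimately show ?thesis by blast
qed auto

section \<open>Acyclic matrices are M-matrices\<close>

text \<open>Well-foundedness of the converse edge relation, loops excepted, says that the matrix is
  upper triangular up to a simultaneous permutation of rows and columns.\<close>
lemma M_matrix_if_wf:
  assumes U: "U \<in> carrier_mat n n"
    and diag: "\<And>i. i < n \<Longrightarrow> 0 \<le> U $$ (i, i)"
    and off: "\<And>i j. i < n \<Longrightarrow> j < n \<Longrightarrow> i \<noteq> j \<Longrightarrow> U $$ (i, j) \<le> 0"
    and wf: "wf r"
    and r: "\<And>i j. i < n \<Longrightarrow> j < n \<Longrightarrow> i \<noteq> j \<Longrightarrow> U $$ (i, j) \<noteq> 0 \<Longrightarrow> (j, i) \<in> r"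
  shows "M_matrix U"
proof -
  \<comment> \<open>For \<open>n = 0\<close> the spectral radius is an unspecified number, which \<open>\<alpha>\<close> must not be below.\<close>
  define \<alpha> where "\<alpha> = (if n = 0 then spectral_radius (map_mat complex_of_real (0\<^sub>m 0 0))
    else (\<Sum>i<n. U $$ (i, i)))"
  define P where "P = \<alpha> \<cdot>\<^sub>m 1\<^sub>m n - U"
  have P: "P \<in> carrier_mat n n" unfolding P_def using U by (simp add: minus_carrier_mat)
  have P_nth: "P $$ (i, j) = (if i = j then \<alpha> else 0) - U $$ (i, j)" if "i < n" "j < n" for i j
    using that U unfolding P_def by simp
  have diag_le: "U $$ (i, i) \<le> \<alpha>" if "i < n" for i
    unfolding \<alpha>_def using that diag by (auto intro: member_le_sum)
  have P_nonneg: "0 \<le> P $$ (i, j)" if "i < n" "j < n" for i j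
    using that off[OF that] diag_le by (auto simp: P_nth)
  have "spectral_radius (map_mat complex_of_real P) \<le> \<alpha>"
  proof (cases "n = 0")
    case True
    then have "map_mat complex_of_real P = map_mat complex_of_real (0\<^sub>m 0 0)"
      using P by (intro eq_matI) auto
    then show ?thesis using True by (simp add: \<alpha>_def)
  next
    case False
    then have n: "n > 0" by simp
    let ?C = "map_mat complex_of_real P"
    have C: "?C \<in> carrier_mat n n" using P by simp
    obtain k where k: "eigenvalue ?C k" and sr: "spectral_radius ?C = norm k"
      using spectral_radius_mem_max(1)[OF C n] unfolding spectrum_def by auto
    obtain v where v: "v \<in> carrier_vec n" "v \<noteq> 0\<^sub>v n" "?C *\<^sub>v v = k \<cdot>\<^sub>v v"
      using k C unfolding eigenvalue_def eigenvector_def by auto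
    define T where "T = {i. i < n \<and> v $ i \<noteq> 0}"
    have "T \<noteq> {}"
    proof
      assume "T = {}"
      then have "v = 0\<^sub>v n" using v(1) unfolding T_def by (intro eq_vecI) auto
      then show False using v(2) by simp
    qed
    \<comment> \<open>In row \<open>i\<close> of the eigenvalue equation only the diagonal term survives.\<close>
    then obtain i where i: "i \<in> T" and least: "\<And>j. (j, i) \<in> r \<Longrightarrow> j \<notin> T"
      using wf by (metis wf_eq_minimal ex_in_conv)
    have i': "i < n" "v $ i \<noteq> 0" using i unfolding T_def by auto
    have zero: "?C $$ (i, j) * v $ j = 0" if "j < n" "j \<noteq> i" for j
    proof (cases "v $ j = 0")
      case False
      then have "U $$ (i, j) = 0"
        using r[of i j] least[of j] that i' unfolding T_def by auto
      then show ?thesis using that i' P by (simp add: P_nth)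
    qed simp
    have "k * v $ i = (?C *\<^sub>v v) $ i" using v i' by simp
    also have "\<dots> = (\<Sum>j<n. ?C $$ (i, j) * v $ j)"
      by (rule mult_mat_vec_nth_sum[OF C v(1) i'(1)])
    also have "\<dots> = ?C $$ (i, i) * v $ i"
    proof -
      have "(\<Sum>j\<in>{..<n} - {i}. ?C $$ (i, j) * v $ j) = 0"
        using zero by (intro sum.neutral) blast
      then show ?thesis using i' by (simp add: sum.remove[of "{..<n}" i])
    qed
    finally have "k = complex_of_real (P $$ (i, i))" using i' P by simp
    then have "norm k = P $$ (i, i)" using P_nonneg[OF i'(1) i'(1)] by simp
    then show ?thesis
      using sr P_nth[OF i'(1) i'(1)] diag[OF i'(1)] by simp
  qed
  moreover have "U = \<alpha> \<cdot>\<^sub>m 1\<^sub>m n - P"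
    unfolding P_def using U by (intro eq_matI) auto
  ultimately show ?thesis unfolding M_matrix_def using P P_nonneg by blast
qed

section \<open>Singularity of principal submatrices\<close>

lemma invertible_mat_iff_det:
  fixes B :: "'a :: field mat"
  assumes B: "B \<in> carrier_mat m m"
  shows "invertible_mat B \<longleftrightarrow> det B \<noteq> 0"
proof
  assume "invertible_mat B"
  then obtain C where C: "B * C = 1\<^sub>m m" "C * B = 1\<^sub>m (dim_row C)"
    using B unfolding invertible_mat_def inverts_mat_def by auto
  have "dim_col C = m" using arg_cong[OF C(1), of dim_col] by simp
  moreover have "dim_row C = m" using arg_cong[OF C(2), of dim_col] B by simp
  ultimately have "C \<in> carrier_mat m m" by auto
  then have "det B * det C = 1" using det_mult[OF B, of C] C(1) by simp
  then show "det B \<noteq> 0" by auto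
next
  assume "det B \<noteq> 0"
  then show "invertible_mat B"
    using det_non_zero_imp_unit[OF B] B unfolding invertible_mat_def inverts_mat_def
    by (auto simp: Units_def ring_mat_def)
qed

lemma bij_betw_pick:
  assumes "finite J"
  shows "bij_betw (pick J) {..<card J} J"
proof -
  have inj: "inj_on (pick J) {..<card J}"
    by (rule inj_onI) (metis lessThan_iff pick_mono_le nat_neq_iff)
  have "pick J ` {..<card J} = J"
    using assms inj by (intro card_subset_eq) (auto simp: card_image pick_in_set_le)
  then show ?thesis using inj by (simp add: bij_betw_def)
qed

lemma not_invertible_principal_submatrix_iff:
  fixes X :: "'a :: field mat"
  assumes X: "X \<in> carrier_mat n n" and J: "J \<subseteq> {..<n}"
  shows "\<not> invertible_mat (submatrix X J J) \<longleftrightarrow>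
    (\<exists>v. (\<exists>j\<in>J. v j \<noteq> 0) \<and> (\<forall>i\<in>J. (\<Sum>j\<in>J. X $$ (i, j) * v j) = 0))" (is "_ = ?R")
proof -
  let ?B = "submatrix X J J"
  define m where "m = card J"
  have fin: "finite J" using J finite_subset by blast
  have eqJ: "{i. i < n \<and> i \<in> J} = J" using J by auto
  have B: "?B \<in> carrier_mat m m"
    using X by (auto simp: dim_submatrix eqJ m_def)
  have nth: "?B $$ (p, q) = X $$ (pick J p, pick J q)" if "p < m" "q < m" for p q
    using submatrix_index[of p X J q J] that X by (simp add: eqJ m_def)
  have bij: "bij_betw (pick J) {..<m} J" unfolding m_def by (rule bij_betw_pick[OF fin])
  have mult: "(?B *\<^sub>v w) $ p = (\<Sum>j\<in>J. X $$ (pick J p, j) * v j)"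
    if w: "w \<in> carrier_vec m" and p: "p < m" and wv: "\<And>q. q < m \<Longrightarrow> w $ q = v (pick J q)" for w v p
  proof -
    have "(?B *\<^sub>v w) $ p = (\<Sum>q<m. ?B $$ (p, q) * w $ q)" by (rule mult_mat_vec_nth_sum[OF B w p])
    also have "\<dots> = (\<Sum>q<m. X $$ (pick J p, pick J q) * v (pick J q))"
      using nth p wv by simp
    also have "\<dots> = (\<Sum>j\<in>J. X $$ (pick J p, j) * v j)" by (rule sum.reindex_bij_betw[OF bij])
    finally show ?thesis .
  qed
  have "\<not> invertible_mat ?B \<longleftrightarrow> (\<exists>w. w \<in> carrier_vec m \<and> w \<noteq> 0\<^sub>v m \<and> ?B *\<^sub>v w = 0\<^sub>v m)"
    using invertible_mat_iff_det[OF B] det_0_iff_vec_prod_zero_field[OF B] by simp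
  also have "\<dots> \<longleftrightarrow> ?R"
  proof
    assume "\<exists>w. w \<in> carrier_vec m \<and> w \<noteq> 0\<^sub>v m \<and> ?B *\<^sub>v w = 0\<^sub>v m"
    then obtain w where w: "w \<in> carrier_vec m" "w \<noteq> 0\<^sub>v m" "?B *\<^sub>v w = 0\<^sub>v m" by blast
    define v where "v j = w $ (inv_into {..<m} (pick J) j)" for j
    have wv: "w $ q = v (pick J q)" if "q < m" for q
      using that bij unfolding v_def by (simp add: bij_betw_inv_into_left)
    have "\<exists>q<m. w $ q \<noteq> 0"
    proof (rule ccontr)
      assume "\<not> ?thesis"
      then have "w = 0\<^sub>v m" using w(1) by (intro eq_vecI) auto
      then show False using w(2) by simp
    qed
    then have "\<exists>j\<in>J. v j \<noteq> 0" using wv bij by (metis bij_betwE lessThan_iff)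
    moreover have "(\<Sum>j\<in>J. X $$ (i, j) * v j) = 0" if "i \<in> J" for i
    proof -
      have "i \<in> pick J ` {..<m}" using that bij by (simp add: bij_betw_def)
      then obtain p where p: "p < m" "i = pick J p" by auto
      show ?thesis using mult[OF w(1) p(1) wv] w(3) p by simp
    qed
    ultimately show ?R by blast
  next
    assume ?R
    then obtain v j where v: "j \<in> J" "v j \<noteq> 0" "\<forall>i\<in>J. (\<Sum>j\<in>J. X $$ (i, j) * v j) = 0" by blast
    define w where "w = vec m (\<lambda>q. v (pick J q))"
    have w: "w \<in> carrier_vec m" and wv: "\<And>q. q < m \<Longrightarrow> w $ q = v (pick J q)"
      unfolding w_def by auto
    have "j \<in> pick J ` {..<m}" using v(1) bij by (simp add: bij_betw_def)
    then obtain q where "q < m" "v (pick J q) \<noteq> 0" using v(2) by auto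
    then have "w \<noteq> 0\<^sub>v m" using wv by force
    moreover have "?B *\<^sub>v w = 0\<^sub>v m"
    proof (rule eq_vecI)
      fix p assume "p < dim_vec (0\<^sub>v m)"
      then have p: "p < m" by simp
      then have "pick J p \<in> J" using bij by (auto simp: bij_betw_def)
      then show "(?B *\<^sub>v w) $ p = 0\<^sub>v m $ p" using mult[OF w p wv] v(3) p by simp
    qed (use B in simp)
    ultimately show "\<exists>w. w \<in> carrier_vec m \<and> w \<noteq> 0\<^sub>v m \<and> ?B *\<^sub>v w = 0\<^sub>v m" using w by blast
  qed
  finally show ?thesis .
qed

lemma not_invertible_principal_submatrix_left:
  fixes X :: "'a :: field mat"
  assumes X: "X \<in> carrier_mat n n" and J: "J \<subseteq> {..<n}"
    and v: "j \<in> J" "v j \<noteq> 0" "\<And>i. i \<in> J \<Longrightarrow> (\<Sum>j\<in>J. v j * X $$ (j, i)) = 0"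
  shows "\<not> invertible_mat (submatrix X J J)"
proof -
  let ?B = "submatrix X J J" and ?T = "transpose_mat X"
  have T: "?T \<in> carrier_mat n n" using X by simp
  have eqJ: "{i. i < n \<and> i \<in> J} = J" using J by auto
  have B: "?B \<in> carrier_mat (card J) (card J)" using X by (auto simp: dim_submatrix eqJ)
  have fin: "finite J" using J finite_subset by blast
  have "submatrix ?T J J = transpose_mat ?B"
  proof (rule eq_matI)
    fix p q assume "p < dim_row (transpose_mat ?B)" "q < dim_col (transpose_mat ?B)"
    then have pq: "p < card J" "q < card J" using B by auto
    have "pick J p < n" "pick J q < n" using pq J pick_in_set_le by blast+
    then show "submatrix ?T J J $$ (p, q) = transpose_mat ?B $$ (p, q)"
      using pq X B by (simp add: submatrix_index eqJ)
  qed (use X B in \<open>auto simp: dim_submatrix eqJ\<close>)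
  moreover have "\<not> invertible_mat (submatrix ?T J J)"
    unfolding not_invertible_principal_submatrix_iff[OF T J]
  proof (intro exI conjI ballI)
    show "\<exists>j\<in>J. v j \<noteq> 0" using v by blast
    fix i assume i: "i \<in> J"
    then have "(\<Sum>j\<in>J. ?T $$ (i, j) * v j) = (\<Sum>j\<in>J. v j * X $$ (j, i))"
      using X J by (intro sum.cong) (auto simp: subset_iff)
    then show "(\<Sum>j\<in>J. ?T $$ (i, j) * v j) = 0" using v(3)[OF i] by simp
  qed
  ultimately show ?thesis
    using B invertible_mat_iff_det[OF B] invertible_mat_iff_det[of "transpose_mat ?B" "card J"]
      det_transpose[OF B] by simp
qed

lemma rtrancl_leaves_set:
  assumes "(i, j) \<in> r\<^sup>*" "i \<in> T" "j \<notin> T"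
  shows "\<exists>p q. (i, p) \<in> r\<^sup>* \<and> p \<in> T \<and> (p, q) \<in> r \<and> q \<notin> T \<and> (q, j) \<in> r\<^sup>*"
  using assms
proof (induction rule: converse_rtrancl_induct)
  case (step y z)
  then show ?case
    by (cases "z \<in> T") (blast intro: converse_rtrancl_into_rtrancl)+
qed simp

section \<open>Pivots of an M-matrix\<close>

text \<open>The properties of an M-matrix on which the pivot analysis rests: nonpositive off-diagonal
  entries, and for every \<open>\<epsilon> > 0\<close> a positive vector \<open>x\<close> with \<open>A x \<ge> - \<epsilon> x\<close>. The matrix is
  a function of its indices, which are relevant below \<open>n\<close> only.\<close>
locale approx_M =
  fixes n :: nat and a :: "nat \<Rightarrow> nat \<Rightarrow> real"
  assumes offdiag: "i < n \<Longrightarrow> j < n \<Longrightarrow> i \<noteq> j \<Longrightarrow> a i j \<le> 0"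
    and approx: "0 < \<epsilon> \<Longrightarrow> \<exists>x. (\<forall>i<n. 0 < x i) \<and> (\<forall>i<n. - \<epsilon> * x i \<le> (\<Sum>j<n. a i j * x j))"
begin

text \<open>The edges of the graph of the matrix.\<close>
definition edges :: "(nat \<times> nat) set" where
  "edges = {(i, j). i < n \<and> j < n \<and> a i j \<noteq> 0}"

text \<open>Access along a possibly empty path. It is reflexive also at indices outside the graph.\<close>
definition acc :: "nat \<Rightarrow> nat \<Rightarrow> bool" where
  "acc i j \<longleftrightarrow> (i, j) \<in> edges\<^sup>*"

text \<open>The class of \<open>k\<close>, which is empty for \<open>k \<ge> n\<close>.\<close>
definition cls :: "nat \<Rightarrow> nat set" where
  "cls k = {i. i < n \<and> acc k i \<and> acc i k}"

text \<open>\<open>k\<close> is the largest element of its class.\<close>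
definition top_of_class :: "nat \<Rightarrow> bool" where
  "top_of_class k \<longleftrightarrow> (\<forall>i\<in>cls k. i \<le> k)"

lemma acc_refl [simp]: "acc i i"
  by (simp add: acc_def)

lemma acc_trans: "acc i j \<Longrightarrow> acc j k \<Longrightarrow> acc i k"
  unfolding acc_def by (rule rtrancl_trans)

lemma acc_edge: "i < n \<Longrightarrow> j < n \<Longrightarrow> a i j \<noteq> 0 \<Longrightarrow> acc i j"
  unfolding acc_def edges_def by blast

lemma cls_subset: "cls k \<subseteq> {..<n}"
  by (auto simp: cls_def)

lemma finite_cls [simp]: "finite (cls k)"
  using cls_subset finite_subset by blast

lemma self_in_cls: "k < n \<Longrightarrow> k \<in> cls k"
  by (simp add: cls_def)

lemma cls_eq: "i \<in> cls k \<Longrightarrow> cls i = cls k"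
  unfolding cls_def by (auto intro: acc_trans)

text \<open>The positive vectors supplied by the second assumption of the locale.\<close>
definition super_solution :: "real \<Rightarrow> (nat \<Rightarrow> real) \<Rightarrow> bool" where
  "super_solution \<epsilon> x \<longleftrightarrow>
     (\<forall>i<n. 0 < x i) \<and> (\<forall>i<n. - \<epsilon> * x i \<le> (\<Sum>j<n. a i j * x j))"

text \<open>In row \<open>i\<close> all off-diagonal terms but the one at \<open>j\<close> can be dropped, being nonpositive.\<close>
lemma super_solution_edge:
  assumes x: "super_solution \<epsilon> x" and e: "\<epsilon> \<le> 1" and ij: "i < n" "j < n" "i \<noteq> j"
  shows "- a i j * x j \<le> (1 + \<bar>a i i\<bar>) * x i"
proof -
  have pos: "\<And>l. l < n \<Longrightarrow> 0 < x l" and super: "- \<epsilon> * x i \<le> (\<Sum>l<n. a i l * x l)"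
    using x ij unfolding super_solution_def by auto
  have "(\<Sum>l<n. a i l * x l) \<le> (\<Sum>l\<in>{i, j}. a i l * x l)"
  proof -
    have "(\<Sum>l<n. a i l * x l) = (\<Sum>l\<in>{i, j}. a i l * x l) + (\<Sum>l\<in>{..<n} - {i, j}. a i l * x l)"
      using ij sum.subset_diff[of "{i, j}" "{..<n}"] by (simp add: add.commute)
    moreover have "(\<Sum>l\<in>{..<n} - {i, j}. a i l * x l) \<le> 0"
      using offdiag ij pos by (intro sum_nonpos mult_nonpos_nonneg) (auto simp: less_imp_le)
    ultimately show ?thesis by simp
  qed
  then have "- a i j * x j \<le> \<epsilon> * x i + a i i * x i" using super ij by simp
  also have "\<dots> \<le> 1 * x i + \<bar>a i i\<bar> * x i"
    using pos[OF ij(1)] e by (intro add_mono mult_right_mono) auto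
  finally show ?thesis by (simp add: algebra_simps)
qed

text \<open>A Harnack inequality: the constant depends neither on \<open>\<epsilon>\<close> nor on \<open>x\<close>.\<close>
lemma super_solution_harnack:
  assumes "acc i j" "i < n"
  shows "\<exists>C>0. \<forall>\<epsilon> x. super_solution \<epsilon> x \<longrightarrow> \<epsilon> \<le> 1 \<longrightarrow> x j \<le> C * x i"
  using assms unfolding acc_def
proof (induction rule: converse_rtrancl_induct)
  case base
  show ?case by (intro exI[of _ 1]) simp
next
  case (step y z)
  have yz: "y < n" "z < n" "a y z \<noteq> 0" using step.hyps(1) by (auto simp: edges_def)
  obtain C where C: "C > 0" "\<And>\<epsilon> x. super_solution \<epsilon> x \<Longrightarrow> \<epsilon> \<le> 1 \<Longrightarrow> x j \<le> C * x z"
    using step.IH yz by blast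
  show ?case
  proof (cases "y = z")
    case True
    then show ?thesis using C by blast
  next
    case False
    define D where "D = (1 + \<bar>a y y\<bar>) / (- a y z)"
    have neg: "- a y z > 0" using offdiag[OF yz(1,2) False] yz(3) by simp
    have D: "D > 0" unfolding D_def using neg by (intro divide_pos_pos) auto
    have "x j \<le> (C * D) * x y" if "super_solution \<epsilon> x" "\<epsilon> \<le> 1" for \<epsilon> x
    proof -
      have "x z \<le> D * x y"
        using super_solution_edge[OF that yz(1,2) False] neg unfolding D_def
        by (simp add: field_simps)
      then have "C * x z \<le> C * (D * x y)" using C by (intro mult_left_mono) auto
      then show ?thesis using C(2)[OF that] by (simp add: mult.assoc)
    qed
    moreover have "C * D > 0" using C D by simp
    ultimately show ?thesis by blast
  qed
qed

text \<open>A nonnegative combination \<open>u\<close> of the rows of the diagonal block of a class that has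
  nonpositive entries off \<open>k\<close> must have a nonnegative entry at \<open>k\<close>, and a positive one as soon as
  another entry is nonzero. The numbers \<open>D j\<close> are Harnack constants.\<close>
lemma pivot_lower_bound:
  assumes k: "k < n" and w: "\<And>i. i \<in> cls k \<Longrightarrow> 0 \<le> w i"
  defines "u \<equiv> \<lambda>j. \<Sum>i\<in>cls k. w i * a i j"
  assumes u: "\<And>j. j \<in> cls k \<Longrightarrow> j \<noteq> k \<Longrightarrow> u j \<le> 0"
  shows "\<exists>D. (\<forall>j\<in>cls k. 0 < D j) \<and> (\<Sum>j\<in>cls k - {k}. - u j / D j) \<le> u k"
proof -
  let ?J = "cls k"
  have J: "i < n" "acc k i" "acc i k" if "i \<in> ?J" for i
    using that by (auto simp: cls_def)
  have kJ: "k \<in> ?J" using k by (rule self_in_cls)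
  have "\<forall>i\<in>?J. \<exists>C>0. \<forall>\<epsilon> x. super_solution \<epsilon> x \<longrightarrow> \<epsilon> \<le> 1 \<longrightarrow> x i \<le> C * x k"
    using super_solution_harnack J k by blast
  then obtain C where C: "\<And>i. i \<in> ?J \<Longrightarrow> C i > 0"
    "\<And>i \<epsilon> x. i \<in> ?J \<Longrightarrow> super_solution \<epsilon> x \<Longrightarrow> \<epsilon> \<le> 1 \<Longrightarrow> x i \<le> C i * x k"
    by metis
  have "\<forall>i\<in>?J. \<exists>C>0. \<forall>\<epsilon> x. super_solution \<epsilon> x \<longrightarrow> \<epsilon> \<le> 1 \<longrightarrow> x k \<le> C * x i"
    using super_solution_harnack J by blast
  then obtain D where D: "\<And>i. i \<in> ?J \<Longrightarrow> D i > 0"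
    "\<And>i \<epsilon> x. i \<in> ?J \<Longrightarrow> super_solution \<epsilon> x \<Longrightarrow> \<epsilon> \<le> 1 \<Longrightarrow> x k \<le> D i * x i"
    by metis
  define S where "S = (\<Sum>j\<in>?J - {k}. - u j / D j)"
  define K where "K = (\<Sum>i\<in>?J. w i * C i)"
  have K: "K \<ge> 0" unfolding K_def using w C(1) by (intro sum_nonneg) (auto simp: less_imp_le)
  have bound: "S \<le> u k + \<epsilon> * K" if e: "0 < \<epsilon>" "\<epsilon> \<le> 1" for \<epsilon>
  proof -
    obtain x where x: "super_solution \<epsilon> x" using approx[OF e(1)] unfolding super_solution_def by blast
    have pos: "\<And>l. l < n \<Longrightarrow> 0 < x l" using x unfolding super_solution_def by blast
    have row: "- \<epsilon> * x i \<le> (\<Sum>j\<in>?J. a i j * x j)" if i: "i \<in> ?J" for i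
    proof -
      have "- \<epsilon> * x i \<le> (\<Sum>j<n. a i j * x j)"
        using x J(1)[OF i] unfolding super_solution_def by blast
      also have "\<dots> = (\<Sum>j\<in>?J. a i j * x j) + (\<Sum>j\<in>{..<n} - ?J. a i j * x j)"
        using cls_subset sum.subset_diff[of ?J "{..<n}"] by (simp add: add.commute)
      also have "(\<Sum>j\<in>{..<n} - ?J. a i j * x j) \<le> 0"
        using i J(1)[OF i] pos offdiag
        by (intro sum_nonpos mult_nonpos_nonneg) (auto simp: less_imp_le)
      finally show ?thesis by simp
    qed
    have "- (\<epsilon> * K) * x k = (\<Sum>i\<in>?J. w i * (- \<epsilon> * (C i * x k)))"
      unfolding K_def by (simp add: sum_distrib_left sum_distrib_right sum_negf ac_simps)
    also have "\<dots> \<le> (\<Sum>i\<in>?J. w i * (- \<epsilon> * x i))"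
      using w C(2)[OF _ x e(2)] e
      by (intro sum_mono mult_left_mono mult_left_mono_neg) auto
    also have "\<dots> \<le> (\<Sum>i\<in>?J. w i * (\<Sum>j\<in>?J. a i j * x j))"
      using w row by (intro sum_mono mult_left_mono) auto
    also have "\<dots> = (\<Sum>j\<in>?J. u j * x j)"
      unfolding u_def sum_distrib_left sum_distrib_right by (subst sum.swap) (simp add: mult.assoc)
    also have "\<dots> = u k * x k + (\<Sum>j\<in>?J - {k}. u j * x j)"
      using kJ by (subst sum.remove[of _ k]) auto
    also have "(\<Sum>j\<in>?J - {k}. u j * x j) \<le> (\<Sum>j\<in>?J - {k}. u j * (x k / D j))"
    proof (intro sum_mono mult_left_mono_neg)
      fix j assume j: "j \<in> ?J - {k}"
      then show "x k / D j \<le> x j" using D(1)[of j] D(2)[of j, OF _ x e(2)] by (simp add: field_simps)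
      show "u j \<le> 0" using u j by blast
    qed
    also have "\<dots> = - S * x k"
      unfolding S_def by (simp add: sum_distrib_right sum_negf)
    finally have "S * x k \<le> (u k + \<epsilon> * K) * x k" by (simp add: algebra_simps)
    then show ?thesis using pos[OF k] by simp
  qed
  have "S \<le> u k"
  proof (rule field_le_epsilon)
    fix e :: real assume e: "0 < e"
    define \<epsilon> where "\<epsilon> = min 1 (e / (K + 1))"
    have eps: "0 < \<epsilon>" "\<epsilon> \<le> 1" "\<epsilon> \<le> e / (K + 1)" unfolding \<epsilon>_def using e K by auto
    have "\<epsilon> * K \<le> \<epsilon> * (K + 1)" using eps by simp
    also have "\<dots> \<le> e" using eps(3) K by (simp add: field_simps)
    finally show "S \<le> u k + e" using bound[OF eps(1,2)] by simp
  qed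
  then show ?thesis unfolding S_def using D(1) by blast
qed

end

section \<open>Partial elimination\<close>

text \<open>The state after elimination in the columns below \<open>k\<close>: \<open>U\<close> is the current matrix, \<open>W\<close> the
  product of the row operations so far, and \<open>L\<close> the product of the inverse operations, which is
  the identity from column \<open>k\<close> on. Columns below \<open>k\<close> with a zero pivot have been skipped; the
  last two assumptions record what is known about the pivots met.\<close>
locale partial_elimination = approx_M +
  fixes k :: nat and W L U :: "nat \<Rightarrow> nat \<Rightarrow> real"
  assumes k_le: "k \<le> n"
    and W_nonneg: "i < n \<Longrightarrow> j < n \<Longrightarrow> 0 \<le> W i j"
    and W_diag: "i < n \<Longrightarrow> W i i = 1"
    and W_upper: "i < j \<Longrightarrow> j < n \<Longrightarrow> W i j = 0"
    and W_acc: "i < n \<Longrightarrow> j < n \<Longrightarrow> W i j \<noteq> 0 \<Longrightarrow> acc i j"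
    and U_eq: "i < n \<Longrightarrow> j < n \<Longrightarrow> U i j = (\<Sum>l<n. W i l * a l j)"
    and L_diag: "i < n \<Longrightarrow> L i i = 1"
    and L_upper: "i < j \<Longrightarrow> j < n \<Longrightarrow> L i j = 0"
    and L_lower: "j < i \<Longrightarrow> i < n \<Longrightarrow> L i j \<le> 0"
    and L_rest: "i < n \<Longrightarrow> j < n \<Longrightarrow> k \<le> j \<Longrightarrow> i \<noteq> j \<Longrightarrow> L i j = 0"
    and LU: "i < n \<Longrightarrow> j < n \<Longrightarrow> a i j = (\<Sum>l<n. L i l * U l j)"
    and U_off: "i < n \<Longrightarrow> j < n \<Longrightarrow> i \<noteq> j \<Longrightarrow> U i j \<le> 0"
    and U_elim: "j < k \<Longrightarrow> j < i \<Longrightarrow> i < n \<Longrightarrow> U j j \<noteq> 0 \<Longrightarrow> U i j = 0"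
    and U_nonneg: "j < k \<Longrightarrow> 0 \<le> U j j"
    and U_pos: "j < k \<Longrightarrow> \<not> top_of_class j \<Longrightarrow> 0 < U j j"
begin

lemma U_acc:
  assumes "i < n" "j < n" "U i j \<noteq> 0"
  shows "acc i j"
proof -
  obtain l where "l < n" "W i l * a l j \<noteq> 0"
    using assms(3) sum.neutral[of "{..<n}" "\<lambda>l. W i l * a l j"] by (auto simp: U_eq[OF assms(1,2)])
  then show ?thesis using W_acc acc_edge acc_trans assms by (metis mult_eq_0_iff)
qed

text \<open>A path that starts and ends in a class stays inside it, so that elimination acts on the diagonal
  block of a class without reference to the rest of the matrix.\<close>
lemma U_eq_class:
  assumes i: "i \<in> cls c" and j: "j \<in> cls c"
  shows "U i j = (\<Sum>l\<in>cls c. W i l * a l j)"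
proof -
  have n: "i < n" "j < n" and ji: "acc j i"
    using i j by (auto simp: cls_def intro: acc_trans)
  have "W i l * a l j = 0" if l: "l < n" "l \<notin> cls c" for l
  proof (rule ccontr)
    assume "W i l * a l j \<noteq> 0"
    then have "acc i l" "acc l j" using W_acc[OF n(1) l(1)] acc_edge[OF l(1) n(2)] by auto
    then have "l \<in> cls c" using i j l(1) by (auto simp: cls_def intro: acc_trans)
    then show False using l by simp
  qed
  then show ?thesis
    unfolding U_eq[OF n] using cls_subset by (intro sum.mono_neutral_right) auto
qed

lemma top_of_class_less:
  assumes "j \<in> cls c" "i \<in> cls c" "j < i"
  shows "\<not> top_of_class j"
  using assms cls_eq[of j c] by (auto simp: top_of_class_def not_le)

lemma U_zero_below:
  assumes "j \<in> cls c" "i \<in> cls c" "j < i" "j < k"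
  shows "U i j = 0"
  using assms top_of_class_less[OF assms(1-3)] U_pos[of j] U_elim[of j i]
  by (auto simp: cls_def)

lemma U_pivot:
  assumes k: "k < n"
  shows U_pivot_nonneg: "0 \<le> U k k" and U_pivot_pos: "\<not> top_of_class k \<Longrightarrow> 0 < U k k"
proof -
  let ?J = "cls k"
  have kJ: "k \<in> ?J" using k by (rule self_in_cls)
  have J: "i < n" if "i \<in> ?J" for i using that cls_subset by blast
  have U_J: "U k j = (\<Sum>i\<in>?J. W k i * a i j)" if "j \<in> ?J" for j
    using U_eq_class[OF kJ that] .
  have off: "U k j \<le> 0" if "j \<in> ?J" "j \<noteq> k" for j
    using U_off k J that by blast
  have "\<exists>D. (\<forall>j\<in>?J. 0 < D j) \<and>
    (\<Sum>j\<in>?J - {k}. - (\<Sum>i\<in>?J. W k i * a i j) / D j) \<le> (\<Sum>i\<in>?J. W k i * a i k)"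
    by (rule pivot_lower_bound[OF k]) (use W_nonneg k J off U_J in auto)
  then obtain D where D: "\<And>j. j \<in> ?J \<Longrightarrow> 0 < D j" and le: "(\<Sum>j\<in>?J - {k}. - U k j / D j) \<le> U k k"
    using U_J kJ by auto
  have terms: "0 \<le> - U k j / D j" if "j \<in> ?J - {k}" for j
    using D[of j] off[of j] that by (simp add: divide_nonpos_pos)
  then have "0 \<le> (\<Sum>j\<in>?J - {k}. - U k j / D j)" by (rule sum_nonneg)
  then show "0 \<le> U k k" using le by linarith
  assume "\<not> top_of_class k"
  then obtain m where m: "m \<in> ?J" "m > k" by (auto simp: top_of_class_def not_le)
  \<comment> \<open>The support of row \<open>k\<close> of \<open>W\<close> in the class contains \<open>k\<close> but not \<open>m\<close>, so the path from \<open>k\<close>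
    to \<open>m\<close> leaves it along an edge from some \<open>p\<close> to some \<open>q\<close>.\<close>
  define T where "T = {i \<in> ?J. W k i \<noteq> 0}"
  have "k \<in> T" "m \<notin> T" using kJ m W_diag[OF k] W_upper[of k m] J by (auto simp: T_def)
  moreover have "acc k m" "acc m k" using m by (auto simp: cls_def)
  ultimately obtain p q where pq: "acc k p" "p \<in> T" "(p, q) \<in> edges" "q \<notin> T" "acc q m"
    using rtrancl_leaves_set[of k m edges T] unfolding acc_def by blast
  have p: "p < n" "q < n" "a p q \<noteq> 0" using pq(3) by (auto simp: edges_def)
  have q: "q \<in> ?J" 
    using p acc_edge[OF p] pq \<open>acc m k\<close> by (auto simp: cls_def intro: acc_trans)
  then have Wq: "W k q = 0" using pq(4) by (simp add: T_def)
  have "p \<in> ?J" "W k p > 0" using pq(2) W_nonneg[OF k p(1)] by (auto simp: T_def)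
  have "p \<noteq> q" "q \<noteq> k" using pq \<open>k \<in> T\<close> by auto
  \<comment> \<open>As \<open>W k q = 0\<close>, the diagonal entry at \<open>q\<close> does not occur in \<open>U k q\<close>, so nothing
    cancels the negative term at \<open>p\<close>.\<close>
  have "U k q = W k p * a p q + (\<Sum>i\<in>?J - {p}. W k i * a i q)"
    unfolding U_J[OF q] using \<open>p \<in> ?J\<close> by (simp add: sum.remove[of ?J p])
  moreover have "W k p * a p q < 0"
    using \<open>W k p > 0\<close> offdiag[OF p(1,2) \<open>p \<noteq> q\<close>] p(3) by (intro mult_pos_neg) auto
  moreover have "(\<Sum>i\<in>?J - {p}. W k i * a i q) \<le> 0"
  proof (rule sum_nonpos)
    fix i assume i: "i \<in> ?J - {p}"
    show "W k i * a i q \<le> 0"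
    proof (cases "i = q")
      case False
      then show ?thesis using i J W_nonneg k offdiag p(2) by (intro mult_nonneg_nonpos) auto
    qed (simp add: Wq)
  qed
  ultimately have "U k q < 0" by linarith
  then have "0 < - U k q / D q" using D[OF q] by (simp add: divide_neg_pos)
  also have "\<dots> \<le> (\<Sum>j\<in>?J - {k}. - U k j / D j)"
    using terms q \<open>q \<noteq> k\<close> by (intro member_le_sum) auto
  finally show "0 < U k k" using le by simp
qed

lemma skip_step:
  assumes k: "k < n" and zero: "U k k = 0"
  shows "partial_elimination n a (Suc k) W L U"
proof (unfold_locales, goal_cases)
  case (6 i j)
  then show ?case by (rule U_eq)
next
  case (11 i j)
  then show ?case by (rule LU)
next
  case (13 j i)
  then have "j < k" using zero by (cases "j = k") auto
  then show ?case using U_elim 13 by blast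
next
  case (14 j)
  then show ?case using zero U_nonneg[of j] by (cases "j = k") auto
next
  case (15 j)
  then show ?case using U_pivot_pos[OF k] U_pos[of j] by (cases "j = k") auto
qed (use k W_nonneg W_diag W_upper W_acc L_diag L_upper L_lower L_rest U_off in auto)

lemma eliminate_step:
  assumes k: "k < n" and nz: "U k k \<noteq> 0"
  shows "\<exists>W L U. partial_elimination n a (Suc k) W L U"
proof -
  have piv: "0 < U k k" using U_pivot_nonneg[OF k] nz by simp
  define m where "m i = (if k < i then U i k / U k k else 0)" for i
  have m_le: "m i \<le> 0" if "i < n" for i
    using that U_off[of i k] k piv unfolding m_def by (auto intro: divide_nonpos_pos)
  have m_k: "m i = 0" if "i \<le> k" for i using that by (simp add: m_def)
  have m_acc: "acc i k" if "i < n" "m i \<noteq> 0" for i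
    using that U_acc[of i k] k by (auto simp: m_def split: if_splits)
  \<comment> \<open>Subtract \<open>m i\<close> times row \<open>k\<close> from row \<open>i\<close>. The inverse operation changes \<open>L\<close> only in
    column \<open>k\<close>, because that column and all later ones are still those of the identity.\<close>
  define W' where "W' i j = W i j - m i * W k j" for i j
  define U' where "U' i j = U i j - m i * U k j" for i j
  define L' where "L' i j = L i j + (if j = k then m i else 0)" for i j
  have U'_low: "U' i j = U i j" if "i \<le> k" for i j
    using that by (simp add: U'_def m_k)
  have Lm: "(\<Sum>l<n. L i l * m l) = m i" if i: "i < n" for i
  proof -
    have "L i l * m l = (if l = i then m i else 0)" if "l < n" for l
      using that i L_rest[of i l] L_diag m_k[of l] by (cases "l \<le> k") auto
    then have "(\<Sum>l<n. L i l * m l) = (\<Sum>l<n. if l = i then m i else 0)" by simp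
    then show ?thesis using i by simp
  qed
  have "partial_elimination n a (Suc k) W' L' U'"
  proof (unfold_locales, goal_cases)
    case 1
    then show ?case using k by simp
  next
    case (2 i j)
    then have "m i * W k j \<le> 0" using m_le W_nonneg k by (intro mult_nonpos_nonneg) auto
    then show ?case using W_nonneg[OF 2] by (simp add: W'_def)
  next
    case (3 i)
    then show ?case using W_diag m_k[of i] W_upper[of k i] by (cases "i \<le> k") (auto simp: W'_def)
  next
    case (4 i j)
    then show ?case
      using W_upper[of i j] m_k[of i] W_upper[of k j] by (cases "i \<le> k") (auto simp: W'_def)
  next
    case (5 i j)
    then show ?case
    proof (cases "W i j = 0")
      case True
      then have "m i \<noteq> 0" "W k j \<noteq> 0" using 5 by (auto simp: W'_def)
      then show ?thesis using m_acc W_acc 5 k acc_trans by blast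
    qed (use W_acc in auto)
  next
    case (6 i j)
    then show ?case
      unfolding U'_def W'_def using U_eq k
      by (simp add: left_diff_distrib sum_subtractf sum_distrib_left mult.assoc)
  next
    case (7 i)
    then show ?case using L_diag m_k[of i] by (auto simp: L'_def)
  next
    case (8 i j)
    then show ?case using L_upper m_k[of i] by (auto simp: L'_def)
  next
    case (9 j i)
    then show ?case using L_lower[of j i] m_le[of i] by (auto simp: L'_def)
  next
    case (10 i j)
    then show ?case using L_rest by (auto simp: L'_def)
  next
    case (11 i j)
    have "(\<Sum>l<n. L' i l * U' l j) = (\<Sum>l<n. L i l * U' l j) + (\<Sum>l<n. if l = k then m i * U' k j else 0)"
      unfolding L'_def sum.distrib[symmetric] by (intro sum.cong) (auto simp: distrib_right)
    also have "\<dots> = (\<Sum>l<n. L i l * U' l j) + m i * U k j"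
      using k U'_low by simp
    also have "(\<Sum>l<n. L i l * U' l j) = (\<Sum>l<n. L i l * U l j) - (\<Sum>l<n. L i l * m l) * U k j"
      unfolding U'_def
      by (simp add: right_diff_distrib sum_subtractf sum_distrib_right mult.assoc)
    finally show ?case using LU[OF 11] Lm[OF 11(1)] by simp
  next
    case (12 i j)
    show ?case
    proof (cases "i \<le> k")
      case True
      then show ?thesis using U_off[OF 12] by (simp add: U'_low)
    next
      case False
      then have ik: "k < i" by simp
      show ?thesis
      proof (cases "j = k")
        case True
        then show ?thesis using ik nz by (simp add: U'_def m_def)
      next
        case False
        then have "0 \<le> m i * U k j"
          using m_le[OF 12(1)] U_off[OF k 12(2)] by (intro mult_nonpos_nonpos) auto
        then show ?thesis using U_off[OF 12] by (simp add: U'_def)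
      qed
    qed
  next
    case (13 j i)
    show ?case
    proof (cases "j = k")
      case True
      then show ?thesis using 13 nz by (simp add: U'_def m_def)
    next
      case False
      then have "j < k" "U j j \<noteq> 0" using 13 U'_low[of j j] by auto
      then show ?thesis using U_elim[of j i] U_elim[of j k] 13 k by (simp add: U'_def)
    qed
  next
    case (14 j)
    then show ?case using U'_low[of j j] piv U_nonneg[of j] by (cases "j = k") auto
  next
    case (15 j)
    then show ?case using U'_low[of j j] piv U_pos[of j] by (cases "j = k") auto
  qed
  then show ?thesis by blast
qed

end

lemma (in approx_M) partial_elimination_0:
  "partial_elimination n a 0 (\<lambda>i j. if i = j then 1 else 0) (\<lambda>i j. if i = j then 1 else 0) a"
  by unfold_locales (auto simp: offdiag if_distrib[of "\<lambda>x. x * _"] cong: if_cong split: if_splits)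

lemma (in approx_M) exists_elimination:
  assumes "k \<le> n"
  shows "\<exists>W L U. partial_elimination n a k W L U"
  using assms
proof (induction k)
  case 0
  then show ?case using partial_elimination_0 by blast
next
  case (Suc k)
  then obtain W L U where "partial_elimination n a k W L U" by auto
  then interpret partial_elimination n a k W L U .
  show ?case
    using skip_step eliminate_step Suc.prems by (cases "U k k = 0") auto
qed

context partial_elimination
begin

text \<open>An edge of \<open>U\<close> joining distinct vertices either leads to another class, which has no access back,
  or stays in its class and goes to a larger index.\<close>
lemma U_edges_wf:
  assumes k: "k = n"
  shows "wf {(j, i). i < n \<and> j < n \<and> i \<noteq> j \<and> U i j \<noteq> 0}" (is "wf ?r")
proof (rule finite_acyclic_wf)
  show "finite ?r" by (rule finite_subset[of _ "{..<n} \<times> {..<n}"]) auto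
  define S where "S = {(j, i). acc i j \<and> (acc j i \<longrightarrow> i < j)}"
  have "trans S" unfolding S_def by (rule transI) (auto intro: acc_trans less_trans)
  moreover have "?r \<subseteq> S"
  proof (clarify)
    fix j i assume ij: "i < n" "j < n" "i \<noteq> j" "U i j \<noteq> 0"
    have "acc i j" using U_acc ij by blast
    moreover have "i < j" if "acc j i"
    proof (rule ccontr)
      assume "\<not> i < j"
      then show False
        using U_zero_below[of j i i] ij that \<open>acc i j\<close> k by (simp add: cls_def)
    qed
    ultimately show "(j, i) \<in> S" by (simp add: S_def)
  qed
  ultimately have "?r\<^sup>+ \<subseteq> S"
    using trancl_mono[of _ ?r S] trancl_id[of S] by (intro subsetI) simp
  then show "acyclic ?r" unfolding acyclic_def S_def by auto
qed

text \<open>If the pivot at \<open>c\<close> vanishes, then so does all of row \<open>c\<close> of \<open>U\<close> within the class of \<open>c\<close>.\<close>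
lemma zero_pivot_left_null:
  assumes k: "k = n" and c: "c < n" and zero: "U c c = 0" and j: "j \<in> cls c"
  shows "(\<Sum>i\<in>cls c. W c i * a i j) = 0"
proof -
  have top: "top_of_class c" using zero U_pos[of c] c k by force
  have "U c j = 0"
  proof (cases "j = c")
    case False
    then have "j < c" using top j by (force simp: top_of_class_def)
    then show ?thesis using U_zero_below[OF j self_in_cls[OF c]] c k by simp
  qed (simp add: zero)
  then show ?thesis using U_eq_class[OF self_in_cls[OF c] j] by simp
qed

text \<open>Back substitution: within a class \<open>U\<close> is upper triangular, and it kills whatever the diagonal
  block of \<open>A\<close> kills.\<close>
lemma nonzero_pivots_trivial_kernel:
  assumes k: "k = n" and nz: "\<And>i. i \<in> cls c \<Longrightarrow> U i i \<noteq> 0"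
    and ker: "\<And>i. i \<in> cls c \<Longrightarrow> (\<Sum>j\<in>cls c. a i j * v j) = 0"
    and j: "j \<in> cls c"
  shows "v j = 0"
proof (rule ccontr)
  assume "v j \<noteq> 0"
  define T where "T = {i \<in> cls c. v i \<noteq> 0}"
  have T: "finite T" "T \<noteq> {}" using j \<open>v j \<noteq> 0\<close> by (auto simp: T_def)
  define i where "i = Max T"
  have iT: "i \<in> T" using Max_in[OF T] by (simp add: i_def)
  have i: "i \<in> cls c" "v i \<noteq> 0" using iT by (auto simp: T_def)
  have zero: "U i l * v l = 0" if "l \<in> cls c - {i}" for l
  proof (cases "l < i")
    case True
    then show ?thesis
      using U_zero_below[of l c i] that i cls_subset[of c] k by auto
  next
    case False
    then have "l \<notin> T" using that Max_ge[OF T(1), of l] by (auto simp: i_def)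
    then show ?thesis using that by (simp add: T_def)
  qed
  have "(\<Sum>l\<in>cls c. U i l * v l) = (\<Sum>l\<in>cls c. \<Sum>p\<in>cls c. W i p * (a p l * v l))"
    using U_eq_class[OF i(1)] by (simp add: sum_distrib_right mult.assoc)
  also have "\<dots> = (\<Sum>p\<in>cls c. W i p * (\<Sum>l\<in>cls c. a p l * v l))"
    unfolding sum_distrib_left by (rule sum.swap)
  also have "\<dots> = 0" using ker by simp
  finally have "U i i * v i + (\<Sum>l\<in>cls c - {i}. U i l * v l) = 0"
    using i(1) by (simp add: sum.remove)
  moreover have "(\<Sum>l\<in>cls c - {i}. U i l * v l) = 0" using zero by (intro sum.neutral) blast
  ultimately show False using nz[OF i(1)] i(2) by simp
qed

end

section \<open>The factorization\<close>

lemma M_matrix_approx_M: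
  assumes A: "A \<in> carrier_mat n n" and M: "M_matrix A"
  shows "approx_M n (\<lambda>i j. A $$ (i, j))"
proof -
  obtain m \<alpha> P where P: "P \<in> carrier_mat m m" "\<And>i j. i < m \<Longrightarrow> j < m \<Longrightarrow> 0 \<le> P $$ (i, j)"
    "spectral_radius (map_mat complex_of_real P) \<le> \<alpha>" "A = \<alpha> \<cdot>\<^sub>m 1\<^sub>m m - P"
    using M unfolding M_matrix_def by auto
  have m: "m = n" using A P(1,4) by auto
  have nth: "A $$ (i, j) = (if i = j then \<alpha> else 0) - P $$ (i, j)" if "i < n" "j < n" for i j
    using that P(1,4) m by simp
  show ?thesis
  proof
    fix i j assume "i < n" "j < n" "i \<noteq> j"
    then show "A $$ (i, j) \<le> 0" using P(2)[of i j] nth m by simp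
  next
    fix \<epsilon> :: real assume "0 < \<epsilon>"
    then have "spectral_radius (map_mat complex_of_real P) < \<alpha> + \<epsilon>" using P(3) by simp
    then obtain x where x: "\<forall>i<m. 0 < x i" "\<forall>i<m. (\<Sum>j<m. P $$ (i, j) * x j) \<le> (\<alpha> + \<epsilon>) * x i"
      using exists_positive_super_solution[OF P(1,2)] by blast
    have "- \<epsilon> * x i \<le> (\<Sum>j<n. A $$ (i, j) * x j)" if i: "i < n" for i
    proof -
      have "(\<Sum>j<n. A $$ (i, j) * x j)
          = (\<Sum>j<n. (if j = i then \<alpha> * x i else 0) - P $$ (i, j) * x j)"
        using nth[OF i] by (intro sum.cong) (auto simp: left_diff_distrib)
      also have "\<dots> = \<alpha> * x i - (\<Sum>j<n. P $$ (i, j) * x j)"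
        using i by (simp add: sum_subtractf)
      finally show ?thesis using x(2) i m by (auto simp: algebra_simps)
    qed
    then show "\<exists>x. (\<forall>i<n. 0 < x i) \<and> (\<forall>i<n. - \<epsilon> * x i \<le> (\<Sum>j<n. A $$ (i, j) * x j))"
      using x(1) m by blast
  qed
qed

lemma has_access_iff_rtrancl:
  assumes X: "X \<in> carrier_mat n n"
  shows "has_access X j k \<longleftrightarrow>
    j < n \<and> k < n \<and> (j, k) \<in> {(p, q). p < n \<and> q < n \<and> X $$ (p, q) \<noteq> 0}\<^sup>*"
proof -
  let ?E = "{(p, q). p < n \<and> q < n \<and> X $$ (p, q) \<noteq> 0}"
  have E: "arcs_ends (mat_graph X) = ?E" and V: "verts (mat_graph X) = {0..<n}"
    using X unfolding mat_graph_def arcs_ends_conv by auto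
  show ?thesis unfolding has_access_def reachable_def E V
  proof
    assume *: "(j, k) \<in> rtrancl_on {0..<n} ?E"
    then show "j < n \<and> k < n \<and> (j, k) \<in> ?E\<^sup>*"
      using in_rtrancl_on_in_F[OF *] rtrancl_on_rtranclI[OF *] by auto
  next
    assume *: "j < n \<and> k < n \<and> (j, k) \<in> ?E\<^sup>*"
    then have "(j, k) \<in> ?E\<^sup>*" "j < n" by auto
    then show "(j, k) \<in> rtrancl_on {0..<n} ?E"
      by (induction rule: rtrancl_induct) (auto intro: rtrancl_on_into_rtrancl_on)
  qed
qed

theorem theorem4p2:
  fixes A :: "real mat" and n :: nat
  assumes "A \<in> carrier_mat n n"
    and "M_matrix A"
  shows "\<exists>L\<in>carrier_mat n n. \<exists>U\<in>carrier_mat n n.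
    A = L * U
    \<and> invertible_mat L \<and> lower_triangular L \<and> M_matrix L
    \<and> M_matrix U
    \<and> (\<forall>j<n. \<forall>k<n. j > k \<longrightarrow> (j, k) \<notin> chi A \<longrightarrow> U $$ (j, k) = 0)
    \<and> (\<forall>j<n. U $$ (j, j) = 0 \<longleftrightarrow> (\<exists>S\<in>singular_classes A. j = Max S))"
proof -
  note A = assms(1)
  interpret approx_M n "\<lambda>i j. A $$ (i, j)" by (rule M_matrix_approx_M[OF assms])
  obtain W l u where "partial_elimination n (\<lambda>i j. A $$ (i, j)) n W l u"
    using exists_elimination[of n] by blast
  then interpret partial_elimination n "\<lambda>i j. A $$ (i, j)" n W l u .
  define L where "L = mat n n (\<lambda>(i, j). l i j)"
  define U where "U = mat n n (\<lambda>(i, j). u i j)"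
  have carrier: "L \<in> carrier_mat n n" "U \<in> carrier_mat n n" unfolding L_def U_def by auto
  have nth: "L $$ (i, j) = l i j" "U $$ (i, j) = u i j" if "i < n" "j < n" for i j
    using that unfolding L_def U_def by auto
  have access: "has_access A j k \<longleftrightarrow> j < n \<and> k < n \<and> acc j k" for j k
    unfolding has_access_iff_rtrancl[OF A] acc_def edges_def ..
  have "mat_classes A = cls ` {..<n}"
    unfolding mat_classes_def quotient_def using A by (auto simp: access cls_def)
  then have singular: "S \<in> singular_classes A \<longleftrightarrow>
      (\<exists>c<n. S = cls c) \<and> \<not> invertible_mat (submatrix A S S)" for S
    unfolding singular_classes_def by auto
  have diag_nonneg: "0 \<le> u j j" if "j < n" for j using U_nonneg[OF that] .
  have diag_zero: "u j j = 0 \<longleftrightarrow> (\<exists>S\<in>singular_classes A. j = Max S)" if j: "j < n" for j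
  proof
    assume zero: "u j j = 0"
    then have "top_of_class j" using U_pos[OF j] by force
    then have "j = Max (cls j)"
      using self_in_cls[OF j] by (intro Max_eqI[symmetric]) (auto simp: top_of_class_def)
    moreover have "\<not> invertible_mat (submatrix A (cls j) (cls j))"
      using zero_pivot_left_null[OF refl j zero] self_in_cls[OF j] W_diag[OF j]
      by (intro not_invertible_principal_submatrix_left[OF A cls_subset, of j _ "W j"]) auto
    ultimately show "\<exists>S\<in>singular_classes A. j = Max S"
      using j by (intro bexI[of _ "cls j"]) (auto simp: singular)
  next
    assume "\<exists>S\<in>singular_classes A. j = Max S"
    then obtain c where c: "c < n" "j = Max (cls c)"
      and sing: "\<not> invertible_mat (submatrix A (cls c) (cls c))"
      by (auto simp: singular)
    have jc: "j \<in> cls c" unfolding c(2) using self_in_cls[OF c(1)] by (intro Max_in) auto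
    show "u j j = 0"
    proof (rule ccontr)
      assume nz: "u j j \<noteq> 0"
      have pivots: "u i i \<noteq> 0" if i: "i \<in> cls c" for i
      proof (cases "i = j")
        case False
        have "i \<le> j" unfolding c(2) using i by (intro Max_ge) auto
        then have "i < j" using False by simp
        then show ?thesis
          using U_pos[of i] top_of_class_less[OF i jc] j by force
      qed (simp add: nz)
      obtain v p where v: "p \<in> cls c" "v p \<noteq> 0"
        and ker: "\<forall>i\<in>cls c. (\<Sum>j\<in>cls c. A $$ (i, j) * v j) = 0"
        using sing unfolding not_invertible_principal_submatrix_iff[OF A cls_subset] by auto
      have "v p = 0"
        by (rule nonzero_pivots_trivial_kernel[where v = v, OF refl pivots bspec[OF ker] v(1)])
      then show False using v(2) by simp
    qed
  qed
  have "A = L * U"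
    using A carrier LU nth by (intro eq_matI) (auto simp: scalar_prod_def atLeast0LessThan)
  moreover have low: "lower_triangular L"
    unfolding lower_triangular_def using carrier nth L_upper by auto
  moreover have "invertible_mat L"
  proof -
    have "det L = prod_list (diag_mat L)"
      using low carrier(1) by (intro det_lower_triangular) (auto simp: lower_triangular_def)
    also have "diag_mat L = map (\<lambda>i. 1) [0..<n]"
      unfolding diag_mat_def using carrier nth L_diag by auto
    finally have "det L \<noteq> 0" by (auto simp: prod_list_zero_iff)
    then show ?thesis by (simp add: invertible_mat_iff_det[OF carrier(1)])
  qed
  moreover have "M_matrix L"
  proof (rule M_matrix_if_wf[OF carrier(1) _ _ wf_less_than])
    fix i j assume ij: "i < n" "j < n" "i \<noteq> j"
    show "L $$ (i, j) \<le> 0" using ij L_lower[of j i] L_upper[of i j] nth by (cases "i < j") auto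
    show "(j, i) \<in> less_than" if "L $$ (i, j) \<noteq> 0"
      using ij that L_upper[of i j] nth by (cases "i < j") auto
  qed (use L_diag nth in auto)
  moreover have "M_matrix U"
    by (rule M_matrix_if_wf[OF carrier(2) _ _ U_edges_wf[OF refl]])
      (use diag_nonneg U_off nth in auto)
  moreover have "U $$ (j, k) = 0" if jk: "j < n" "k < n" "j > k" "(j, k) \<notin> chi A" for j k
  proof (rule ccontr)
    assume "U $$ (j, k) \<noteq> 0"
    then have nz: "u j k \<noteq> 0" using nth jk by simp
    then have "u k k = 0" using U_elim[of k j] jk by auto
    then obtain S where "S \<in> singular_classes A" "k = Max S" using diag_zero[OF jk(2)] by blast
    moreover have "has_access A j k" using U_acc[OF jk(1,2) nz] jk access by simp
    ultimately show False using jk unfolding chi_def by blast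
  qed
  moreover have "\<forall>j<n. U $$ (j, j) = 0 \<longleftrightarrow> (\<exists>S\<in>singular_classes A. j = Max S)"
    using diag_zero nth by simp
  ultimately show ?thesis by (intro bexI[OF _ carrier(1)] bexI[OF _ carrier(2)]) simp
qed

end
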